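(* Let $G$ be a transitive one-ended graph. Then the end of $G$ has infinite vertex degree.
   Context: A graph is transitive if all its vertices lie in the same orbit under the automorphism group. A ray is a one-way infinite path. Two rays of $G$ are in the same end if for every finite vertex set $S$ they have tails in the same component of $G-S$; ends are the equivalence classes, and $G$ is one-ended if it has exactly one end. The vertex degree of an end is the natural number $k$ if the maximal cardinality of a family of pairwise disjoint rays belonging to the end is $k$; if no such number exists the vertex degree is infinite. *)

theory Defs
  imports "Graph_Theory.Graph_Theory" "HOL-Library.Extended_Nat"
begin

text \<open>
  A simple graph of arbitrary cardinality is a \<^locale>\<open>pair_bidirected_digraph\<close>, i.e. a
  symmetric and loop-free set of arcs on a vertex set. (The locale \<^locale>\<open>pair_graph\<close>
  would additionally require the graph to be finite.)
\<close>

definition graph_automorphism ::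
    "'a pair_pre_digraph \<Rightarrow> ('a, 'a \<times> 'a, 'a, 'a \<times> 'a) digraph_isomorphism \<Rightarrow> bool" where
  "graph_automorphism G \<phi> \<longleftrightarrow>
     pre_digraph.digraph_isomorphism (with_proj G) \<phi> \<and> app_iso \<phi> (with_proj G) = with_proj G"

definition transitive_graph :: "'a pair_pre_digraph \<Rightarrow> bool" where
  "transitive_graph G \<longleftrightarrow>
     (\<forall>u \<in> pverts G. \<forall>v \<in> pverts G. \<exists>\<phi>. graph_automorphism G \<phi> \<and> iso_verts \<phi> u = v)"

text \<open>
  A ray is determined by the sequence of its vertices, read from its unique vertex of degree one.
\<close>

definition rays :: "'a pair_pre_digraph \<Rightarrow> (nat \<Rightarrow> 'a) set" where
  "rays G = {r. inj r \<and> (\<forall>i. (r i, r (Suc i)) \<in> parcs G)}"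

text \<open>
  Since the arc relation is symmetric, the strongly connected components of an induced
  subgraph are its components in the sense of undirected graphs.
\<close>

definition components_minus :: "'a pair_pre_digraph \<Rightarrow> 'a set \<Rightarrow> 'a set set" where
  "components_minus G S = pre_digraph.sccs_verts (with_proj G \<restriction> (pverts G - S))"

definition end_rel :: "'a pair_pre_digraph \<Rightarrow> ((nat \<Rightarrow> 'a) \<times> (nat \<Rightarrow> 'a)) set" where
  "end_rel G = {(r, s). r \<in> rays G \<and> s \<in> rays G \<and>
     (\<forall>S. finite S \<and> S \<subseteq> pverts G \<longrightarrow>
        (\<exists>C \<in> components_minus G S. \<exists>m n. r ` {m..} \<subseteq> C \<and> s ` {n..} \<subseteq> C))}"

definition graph_ends :: "'a pair_pre_digraph \<Rightarrow> (nat \<Rightarrow> 'a) set set" where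
  "graph_ends G = rays G // end_rel G"

definition one_ended :: "'a pair_pre_digraph \<Rightarrow> bool" where
  "one_ended G \<longleftrightarrow> (\<exists>!\<omega>. \<omega> \<in> graph_ends G)"

definition disjoint_rays_in :: "(nat \<Rightarrow> 'a) set \<Rightarrow> (nat \<Rightarrow> 'a) set \<Rightarrow> bool" where
  "disjoint_rays_in \<omega> F \<longleftrightarrow> F \<subseteq> \<omega> \<and> pairwise (\<lambda>r s. disjnt (range r) (range s)) F"

definition max_disjoint_rays :: "(nat \<Rightarrow> 'a) set \<Rightarrow> nat \<Rightarrow> bool" where
  "max_disjoint_rays \<omega> k \<longleftrightarrow>
     (\<exists>F. disjoint_rays_in \<omega> F \<and> finite F \<and> card F = k) \<and>
     (\<forall>F. disjoint_rays_in \<omega> F \<longrightarrow> finite F \<and> card F \<le> k)"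

definition end_vertex_degree :: "(nat \<Rightarrow> 'a) set \<Rightarrow> enat" where
  "end_vertex_degree \<omega> =
     (if \<exists>k. max_disjoint_rays \<omega> k then enat (THE k. max_disjoint_rays \<omega> k) else \<infinity>)"

end

theory Submission
  imports Defs
begin

text \<open>
  In a one-ended graph all rays are equivalent, so the end is the set of all rays, and it
  suffices to find \<open>k + 1\<close> disjoint rays for every \<open>k\<close>. A transitive one-ended graph is
  connected, and its vertices all have the same degree.

  If the degree is infinite, disjoint rays can be grown greedily
  (\<open>disjoint_rays_infinite_degree\<close>).

  If the graph is locally finite, suppose first that only boundedly large finite vertex sets
  have at most \<open>k\<close> outer neighbours. Then there is an injection of the vertex set into itself
  that moves every vertex to itself or to a neighbour and misses \<open>k + 1\<close> vertices: Hall's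
  condition for such an injection holds for a suitable choice of the missed vertices, found by a
  matroid-style augmentation (\<open>exists_saturated_set\<close>). The orbits of the missed vertices are
  \<open>k + 1\<close> disjoint rays (\<open>disjoint_rays_of_isoperimetry\<close>).

  Otherwise there are arbitrarily large finite sets with at most \<open>k\<close> outer neighbours.
  Uncrossing translates of such a set along a geodesic ray produces a set \<open>U\<close> that contains the
  ray, stays within bounded distance of it and has finitely many outer neighbours. Were the
  complement of \<open>U\<close> finite, the whole graph would be close to a geodesic ray, which
  transitivity forbids (\<open>geodesic_ray_not_cobounded\<close>). So the complement contains a ray too,
  and the two rays are separated by finitely many vertices (\<open>separated_rays\<close>), contrary to
  one-endedness.
\<close>

section \<open>Systems of distinct representatives\<close>

text \<open>
  Hall's condition for the family \<open>A\<close> indexed by the possibly infinite set \<open>I\<close>. As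
  the union may be infinite, and then has \<open>card\<close> zero, it is only used for families of
  finite sets.
\<close>

definition hall :: "'i set \<Rightarrow> ('i \<Rightarrow> 'b set) \<Rightarrow> bool" where
  "hall I A \<longleftrightarrow> (\<forall>F. finite F \<and> F \<subseteq> I \<longrightarrow> card F \<le> card (\<Union>i\<in>F. A i))"

text \<open>
  Rado's argument: were both removals harmful, two subfamilies would witness it, and the
  submodularity of the size of a union would contradict Hall's condition for their union
  (together with \<open>i\<close>) and their intersection.
\<close>

lemma hall_remove_one:
  assumes H: "hall I A" and fin: "\<And>i. i \<in> I \<Longrightarrow> finite (A i)" and i: "i \<in> I"
    and xy: "x \<noteq> y"
  shows "hall I (A(i := A i - {x})) \<or> hall I (A(i := A i - {y}))"
proof (rule ccontr)
  have key: "\<exists>F. finite F \<and> F \<subseteq> I \<and> i \<notin> F \<and> card ((\<Union>j\<in>F. A j) \<union> (A i - {z})) \<le> card F"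
    if "\<not> hall I (A(i := A i - {z}))" for z
  proof -
    let ?A = "A(i := A i - {z})"
    from that have "\<exists>F. (finite F \<and> F \<subseteq> I) \<and> card (\<Union>j\<in>F. ?A j) < card F"
      by (simp only: hall_def not_all not_imp not_le)
    then obtain F where F: "finite F" "F \<subseteq> I" "card (\<Union>j\<in>F. ?A j) < card F"
      by (elim exE conjE)
    have "i \<in> F"
    proof (rule ccontr)
      assume "i \<notin> F"
      then have "(\<Union>j\<in>F. ?A j) = (\<Union>j\<in>F. A j)" by auto
      moreover have "card F \<le> card (\<Union>j\<in>F. A j)" using F H unfolding hall_def by blast
      ultimately show False using F(3) by simp
    qed
    then have "(\<Union>j\<in>F. ?A j) = (\<Union>j\<in>F - {i}. A j) \<union> (A i - {z})"
      by (auto split: if_splits)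
    moreover have "card F = Suc (card (F - {i}))" using F(1) \<open>i \<in> F\<close> by (rule card.remove)
    ultimately have "card ((\<Union>j\<in>F - {i}. A j) \<union> (A i - {z})) \<le> card (F - {i})"
      using F(3) by simp
    with F show ?thesis by (intro exI[of _ "F - {i}"]) blast
  qed
  assume "\<not> ?thesis"
  then obtain F1 F2 where 1: "finite F1" "F1 \<subseteq> I" "i \<notin> F1"
      "card ((\<Union>j\<in>F1. A j) \<union> (A i - {x})) \<le> card F1"
    and 2: "finite F2" "F2 \<subseteq> I" "i \<notin> F2"
      "card ((\<Union>j\<in>F2. A j) \<union> (A i - {y})) \<le> card F2"
    using key by meson
  let ?P = "(\<Union>j\<in>F1. A j) \<union> (A i - {x})" and ?Q = "(\<Union>j\<in>F2. A j) \<union> (A i - {y})"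
  have fPQ: "finite ?P" "finite ?Q" using 1 2 i fin by auto
  have "?P \<union> ?Q = (\<Union>j\<in>insert i (F1 \<union> F2). A j)" using xy by blast
  moreover have "card (insert i (F1 \<union> F2)) \<le> card (\<Union>j\<in>insert i (F1 \<union> F2). A j)"
    using H[unfolded hall_def, rule_format, of "insert i (F1 \<union> F2)"] 1 2 i by simp
  ultimately have u: "card (F1 \<union> F2) + 1 \<le> card (?P \<union> ?Q)"
    using 1(1,3) 2(1,3) by (metis card_insert_disjoint Suc_eq_plus1 Un_iff finite_UnI)
  have "card (F1 \<inter> F2) \<le> card (\<Union>j\<in>F1 \<inter> F2. A j)"
    using H[unfolded hall_def, rule_format, of "F1 \<inter> F2"] 1 2 by blast
  also have "\<dots> \<le> card (?P \<inter> ?Q)"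
    using fPQ by (intro card_mono) blast+
  finally have n: "card (F1 \<inter> F2) \<le> card (?P \<inter> ?Q)" .
  have "card ?P + card ?Q = card (?P \<union> ?Q) + card (?P \<inter> ?Q)"
    by (rule card_Un_Int[OF fPQ])
  moreover have "card F1 + card F2 = card (F1 \<union> F2) + card (F1 \<inter> F2)"
    by (rule card_Un_Int) (use 1 2 in auto)
  ultimately show False using u n 1(4) 2(4) by linarith
qed

text \<open>
  Zorn's lemma applies because the members of the family are finite: on finitely many indices
  the pointwise intersection of a chain agrees with some member of the chain.
\<close>

lemma hall_minimal:
  fixes A :: "'i \<Rightarrow> 'b set"
  assumes H: "hall I A" and fin: "\<And>i. finite (A i)"
  obtains B where "hall I B" "B \<le> A" "\<And>C. hall I C \<Longrightarrow> C \<le> B \<Longrightarrow> C = B"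
proof -
  let ?S = "{B. hall I B \<and> B \<le> A}"
  have "\<exists>M\<in>?S. \<forall>B\<in>?S. B \<le> M \<longrightarrow> B = M"
  proof (rule predicate_Zorn[where P = "\<lambda>x y. y \<le> x"])
    show "partial_order_on ?S (relation_of (\<lambda>x y. y \<le> x) ?S)"
      by (rule partial_order_on_relation_ofI) auto
  next
    fix \<C> assume "\<C> \<in> Chains (relation_of (\<lambda>x y. y \<le> x) ?S)"
    then have C: "\<And>B. B \<in> \<C> \<Longrightarrow> hall I B \<and> B \<le> A"
      and ch: "\<And>B B'. B \<in> \<C> \<Longrightarrow> B' \<in> \<C> \<Longrightarrow> B \<le> B' \<or> B' \<le> B"
      by (auto simp: Chains_def relation_of_def)
    show "\<exists>u\<in>?S. \<forall>a\<in>\<C>. u \<le> a"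
    proof (cases "\<C> = {}")
      case True then show ?thesis using H by auto
    next
      case False
      define M where "M = (\<lambda>i. \<Inter>B\<in>\<C>. B i)"
      have att: "\<exists>B\<in>\<C>. \<forall>i\<in>F. B i = M i" if "finite F" for F
        using that
      proof (induction F)
        case empty then show ?case using False by auto
      next
        case (insert i F)
        then obtain B where B: "B \<in> \<C>" "\<forall>i\<in>F. B i = M i" by blast
        obtain B' where B': "B' \<in> \<C>" "\<And>D. D \<in> \<C> \<Longrightarrow> card (B' i) \<le> card (D i)"
          using False ex_has_least_nat[of "\<lambda>D. D \<in> \<C>" _ "\<lambda>D. card (D i)"] by blast
        have fB: "finite (D i)" if "D \<in> \<C>" for D
          using C[OF that] fin[of i] by (auto simp: le_fun_def intro: finite_subset)
        have "B' i \<subseteq> D i" if D: "D \<in> \<C>" for D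
        proof (rule ccontr)
          assume n: "\<not> B' i \<subseteq> D i"
          then have "D i \<subset> B' i" using ch[OF D B'(1)] by (auto simp: le_fun_def)
          then have "card (D i) < card (B' i)" using fB[OF B'(1)] by (simp add: psubset_card_mono)
          with B'(2)[OF D] show False by simp
        qed
        then have B'i: "B' i = M i" using B'(1) by (auto simp: M_def)
        consider "B \<le> B'" | "B' \<le> B" using ch B B' by blast
        then show ?case
        proof cases
          case 1
          then have "B i = M i" using B'i B(1) by (auto simp: le_fun_def M_def)
          with B show ?thesis by auto
        next
          case 2
          then have "\<forall>j\<in>F. B' j = M j" using B B'(1)
            by (fastforce simp: le_fun_def M_def)
          with B'i B' show ?thesis by auto
        qed
      qed
      have "hall I M"
        unfolding hall_def
      proof (intro allI impI)
        fix F assume F: "finite F \<and> F \<subseteq> I"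
        then obtain B where B: "B \<in> \<C>" "\<forall>i\<in>F. B i = M i" using att by blast
        then have "(\<Union>i\<in>F. B i) = (\<Union>i\<in>F. M i)" by auto
        then show "card F \<le> card (\<Union>i\<in>F. M i)" using C[OF B(1)] F unfolding hall_def by metis
      qed
      moreover have "M \<le> B" if "B \<in> \<C>" for B using that by (auto simp: M_def le_fun_def)
      moreover have "M \<le> A" using False C by (meson calculation(2) ex_in_conv order_trans)
      ultimately show ?thesis by blast
    qed
  qed
  then obtain M where M: "hall I M" "M \<le> A"
    and min: "\<And>B. hall I B \<and> B \<le> A \<Longrightarrow> B \<le> M \<Longrightarrow> B = M" by blast
  show ?thesis
  proof (rule that[OF M])
    fix C assume "hall I C" "C \<le> M"
    with min[of C] order_trans[OF _ M(2), of C] show "C = M" by blast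
  qed
qed

lemma hall_infinite:
  assumes H: "hall I A" and fin: "\<And>i. i \<in> I \<Longrightarrow> finite (A i)"
  obtains f where "inj_on f I" "\<And>i. i \<in> I \<Longrightarrow> f i \<in> A i"
proof -
  \<comment> \<open>Emptied outside \<open>I\<close>, so that all its members are finite.\<close>
  define A' where "A' = (\<lambda>i. if i \<in> I then A i else {})"
  have "(\<Union>i\<in>F. A' i) = (\<Union>i\<in>F. A i)" if "F \<subseteq> I" for F
    using that by (auto simp: A'_def)
  then have "hall I A'" using H by (auto simp: hall_def)
  moreover have finA': "finite (A' i)" for i using fin by (auto simp: A'_def)
  ultimately obtain B where B: "hall I B" "B \<le> A'" "\<And>C. hall I C \<Longrightarrow> C \<le> B \<Longrightarrow> C = B"
    using hall_minimal by metis
  have finB: "finite (B i)" for i using B(2) finA' by (auto simp: le_fun_def intro: finite_subset)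
  have sing: "\<exists>x. B i = {x}" if i: "i \<in> I" for i
  proof (rule ccontr)
    assume n: "\<nexists>x. B i = {x}"
    have "card {i} \<le> card (\<Union>j\<in>{i}. B j)" using B(1) i unfolding hall_def by blast
    then have "B i \<noteq> {}" by auto
    with n obtain x y where xy: "x \<in> B i" "y \<in> B i" "x \<noteq> y" by blast
    have "C = B" if "hall I C" "C = B(i := B i - {z})" for z C
      by (rule B(3)) (use that in \<open>auto simp: le_fun_def\<close>)
    moreover have "B(i := B i - {z}) \<noteq> B" if "z \<in> B i" for z
      using that by (auto simp: fun_eq_iff)
    ultimately show False using hall_remove_one[OF B(1) finB i xy(3)] xy by blast
  qed
  then obtain f where f: "\<And>i. i \<in> I \<Longrightarrow> B i = {f i}" by metis
  have "inj_on f I"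
  proof (rule inj_onI, rule ccontr)
    fix i j assume ij: "i \<in> I" "j \<in> I" "f i = f j" "i \<noteq> j"
    have "card {i, j} \<le> card (\<Union>k\<in>{i, j}. B k)"
      using B(1)[unfolded hall_def, rule_format, of "{i, j}"] ij by simp
    then show False using f[OF ij(1)] f[OF ij(2)] ij by simp
  qed
  moreover have "f i \<in> A i" if "i \<in> I" for i
    using B(2) f[OF that] that by (auto simp: le_fun_def A'_def split: if_splits)
  ultimately show ?thesis using that by blast
qed

section \<open>Closed neighbourhoods\<close>

text \<open>
  The closed neighbourhood of a vertex set in an arc relation. If it is finite, the number
  \<open>card (closed_nbhd E F) - card F\<close> counts the vertices outside \<open>F\<close> adjacent to \<open>F\<close>;
  bounds on it are written additively below, to avoid truncated subtraction.
\<close>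

definition closed_nbhd :: "('a \<times> 'a) set \<Rightarrow> 'a set \<Rightarrow> 'a set" where
  "closed_nbhd E F = F \<union> E `` F"

lemma closed_nbhd_Un: "closed_nbhd E (A \<union> B) = closed_nbhd E A \<union> closed_nbhd E B"
  by (auto simp: closed_nbhd_def)

lemma closed_nbhd_mono: "A \<subseteq> B \<Longrightarrow> closed_nbhd E A \<subseteq> closed_nbhd E B"
  by (auto simp: closed_nbhd_def)

lemma subset_closed_nbhd: "A \<subseteq> closed_nbhd E A"
  by (auto simp: closed_nbhd_def)

lemma closed_nbhd_Int: "closed_nbhd E (A \<inter> B) \<subseteq> closed_nbhd E A \<inter> closed_nbhd E B"
  by (auto simp: closed_nbhd_def)

lemma card_closed_nbhd_submodular:
  assumes "finite (closed_nbhd E A - X)" "finite (closed_nbhd E B - X)"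
  shows "card (closed_nbhd E (A \<union> B) - X) + card (closed_nbhd E (A \<inter> B) - X)
    \<le> card (closed_nbhd E A - X) + card (closed_nbhd E B - X)"
proof -
  have "closed_nbhd E (A \<union> B) - X = (closed_nbhd E A - X) \<union> (closed_nbhd E B - X)"
    by (auto simp: closed_nbhd_Un)
  moreover have "card (closed_nbhd E (A \<inter> B) - X)
      \<le> card ((closed_nbhd E A - X) \<inter> (closed_nbhd E B - X))"
    using assms(1) closed_nbhd_Int[of E A B] by (intro card_mono) auto
  ultimately show ?thesis using card_Un_Int[OF assms] by simp
qed

section \<open>Constructing disjoint rays\<close>

text \<open>
  An injection that moves every vertex by at most one step and misses the set \<open>X\<close> yields
  disjoint rays: the forward orbits of the points of \<open>X\<close>.
\<close>

lemma disjoint_rays_of_injection: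
  assumes E: "parcs G \<subseteq> pverts G \<times> pverts G"
    and f: "inj_on f (pverts G)" "\<And>v. v \<in> pverts G \<Longrightarrow> f v \<in> closed_nbhd (parcs G) {v}"
    and X: "X \<subseteq> pverts G" "X \<inter> f ` pverts G = {}"
  shows "\<exists>F. disjoint_rays_in (rays G) F \<and> card F = card X"
proof -
  define \<rho> where "\<rho> x i = (f ^^ i) x" for x i
  have fV: "f v \<in> pverts G" if "v \<in> pverts G" for v
    using f(2)[OF that] that E by (auto simp: closed_nbhd_def)
  have V: "\<rho> x i \<in> pverts G" if "x \<in> X" for x i
    using that X(1) by (induction i) (auto simp: \<rho>_def fV)
  have eq: "x = y \<and> i = j" if "x \<in> X" "y \<in> X" "\<rho> x i = \<rho> y j" for x y i j
    using that(3)
  proof (induction i arbitrary: j)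
    case 0
    show ?case
    proof (cases j)
      case 0
      then show ?thesis using "0.prems" by (simp add: \<rho>_def)
    next
      case (Suc j')
      then have "x = f (\<rho> y j')" using "0.prems" by (simp add: \<rho>_def)
      then show ?thesis using V[OF that(2)] X(2) that(1) by blast
    qed
  next
    case (Suc i)
    show ?case
    proof (cases j)
      case 0
      then have "y = f (\<rho> x i)" using Suc.prems by (simp add: \<rho>_def)
      then show ?thesis using V[OF that(1)] X(2) that(2) by blast
    next
      case (Suc j')
      then have "f (\<rho> x i) = f (\<rho> y j')" using Suc.prems by (simp add: \<rho>_def)
      then have "\<rho> x i = \<rho> y j'" using inj_onD[OF f(1)] V that(1,2) by blast
      with Suc.IH[of j'] Suc show ?thesis by simp
    qed
  qed
  have ray: "\<rho> x \<in> rays G" if "x \<in> X" for x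
    unfolding rays_def
  proof (intro CollectI conjI allI)
    show "inj (\<rho> x)" using eq[OF that that] by (auto intro: injI)
    fix i
    have "\<rho> x (Suc i) \<in> closed_nbhd (parcs G) {\<rho> x i}"
      using f(2)[OF V[OF that, of i]] by (simp add: \<rho>_def)
    moreover have "\<rho> x (Suc i) \<noteq> \<rho> x i" using eq[OF that that, of "Suc i" i] by auto
    ultimately show "(\<rho> x i, \<rho> x (Suc i)) \<in> parcs G" by (auto simp: closed_nbhd_def)
  qed
  have "inj_on \<rho> X"
    using eq by (intro inj_onI) metis
  then have "card (\<rho> ` X) = card X" by (rule card_image)
  moreover have "disjoint_rays_in (rays G) (\<rho> ` X)"
    unfolding disjoint_rays_in_def pairwise_def disjnt_def using ray eq by blast
  ultimately show ?thesis by blast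
qed

text \<open>
  The set \<open>X\<close> is built one vertex at a time. A finite set is tight if Hall's inequality
  holds for it with equality. By submodularity tight sets are closed under union, and the
  assumption bounds their size, so there is a largest one; any new vertex outside its
  closed neighbourhood can be added to \<open>X\<close>.
\<close>

lemma exists_saturated_set:
  assumes E: "parcs G \<subseteq> pverts G \<times> pverts G"
    and fin: "\<And>v. v \<in> pverts G \<Longrightarrow> finite (parcs G `` {v})"
    and inf: "infinite (pverts G)"
    and bound: "\<And>F. finite F \<Longrightarrow> F \<subseteq> pverts G \<Longrightarrow>
        card (closed_nbhd (parcs G) F) \<le> card F + k \<Longrightarrow> card F \<le> M"
    and "j \<le> Suc k"
  shows "\<exists>X. finite X \<and> X \<subseteq> pverts G \<and> card X = j
    \<and> hall (pverts G) (\<lambda>v. closed_nbhd (parcs G) {v} - X)"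
proof -
  let ?N = "closed_nbhd (parcs G)"
  have UN: "(\<Union>v\<in>F. ?N {v} - X) = ?N F - X" for F X by (auto simp: closed_nbhd_def)
  have finN: "finite (?N F)" if "finite F" "F \<subseteq> pverts G" for F
  proof -
    have "?N F = F \<union> (\<Union>v\<in>F. parcs G `` {v})" by (auto simp: closed_nbhd_def)
    then show ?thesis using that fin by auto
  qed
  show ?thesis
    using \<open>j \<le> Suc k\<close>
  proof (induction j)
    case 0
    have le: "card F \<le> card (?N F)" if "finite F" "F \<subseteq> pverts G" for F
      using finN[OF that] subset_closed_nbhd by (rule card_mono)
    then show ?case
      by (intro exI[of _ "{}"]) (simp only: hall_def UN, use le in simp)
  next
    case (Suc j)
    then obtain X where X: "finite X" "X \<subseteq> pverts G" "card X = j"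
      and h: "hall (pverts G) (\<lambda>v. ?N {v} - X)" by auto
    have hall: "card F \<le> card (?N F - X)" if "finite F" "F \<subseteq> pverts G" for F
      using h[unfolded hall_def UN, rule_format, of F] that by blast
    define tight where "tight F \<longleftrightarrow> finite F \<and> F \<subseteq> pverts G \<and> card (?N F - X) \<le> card F" for F
    have small: "card F \<le> M" if "tight F" for F
    proof -
      have F: "finite F" "F \<subseteq> pverts G" and t: "card (?N F - X) \<le> card F"
        using that by (auto simp: tight_def)
      have "card (?N F) - card X \<le> card (?N F - X)"
        by (rule diff_card_le_card_Diff[OF X(1)])
      then have "card (?N F) \<le> card F + k" using t X(3) Suc.prems by simp
      then show ?thesis by (rule bound[OF F])
    qed
    have union: "tight (F1 \<union> F2)" if "tight F1" "tight F2" for F1 F2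
    proof -
      have F: "finite F1" "F1 \<subseteq> pverts G" "finite F2" "F2 \<subseteq> pverts G"
        using that by (auto simp: tight_def)
      have "card (?N (F1 \<union> F2) - X) + card (?N (F1 \<inter> F2) - X)
          \<le> card (?N F1 - X) + card (?N F2 - X)"
        by (rule card_closed_nbhd_submodular) (use finN F in auto)
      also have "\<dots> \<le> card F1 + card F2" using that by (auto simp: tight_def intro: add_mono)
      also have "\<dots> = card (F1 \<union> F2) + card (F1 \<inter> F2)" using F by (intro card_Un_Int) auto
      also have "card (F1 \<inter> F2) \<le> card (?N (F1 \<inter> F2) - X)" using F by (intro hall) auto
      finally show ?thesis using F by (simp add: tight_def)
    qed
    have "tight {}" by (simp add: tight_def closed_nbhd_def)
    moreover have "\<forall>F. tight F \<longrightarrow> card F \<le> M" using small by blast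
    ultimately have "\<exists>T. tight T \<and> (\<forall>F. tight F \<longrightarrow> card F \<le> card T)"
      using ex_has_greatest_nat[of tight "{}" card "Suc M"] by (simp add: less_Suc_eq_le)
    then obtain T where T: "tight T" "\<And>F. tight F \<Longrightarrow> card F \<le> card T" by blast
    have subT: "F \<subseteq> T" if "tight F" for F
    proof -
      have "finite (F \<union> T)" using that T(1) by (auto simp: tight_def)
      then have "T = F \<union> T"
        using T(2)[OF union[OF that T(1)]] by (intro card_seteq) auto
      then show ?thesis by blast
    qed
    have "finite (?N T \<union> X)" using finN T(1) X(1) by (auto simp: tight_def)
    then have "pverts G - (?N T \<union> X) \<noteq> {}"
      using inf by (intro infinite_imp_nonempty Diff_infinite_finite)
    then obtain x where x: "x \<in> pverts G" "x \<notin> ?N T" "x \<notin> X" by blast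
    have "hall (pverts G) (\<lambda>v. ?N {v} - insert x X)"
      unfolding hall_def UN
    proof (intro allI impI)
      fix F assume F: "finite F \<and> F \<subseteq> pverts G"
      show "card F \<le> card (?N F - insert x X)"
      proof (cases "tight F")
        case True
        then have "x \<notin> ?N F" using subT closed_nbhd_mono x(2) by blast
        then have "?N F - insert x X = ?N F - X" by blast
        then show ?thesis using hall F by simp
      next
        case False
        then have "card F < card (?N F - X)" using F by (simp add: tight_def)
        moreover have "card (?N F - X) - card {x} \<le> card (?N F - X - {x})"
          by (rule diff_card_le_card_Diff) simp
        moreover have "?N F - insert x X = ?N F - X - {x}" by blast
        ultimately show ?thesis by simp
      qed
    qed
    with X x show ?case
      by (intro exI[of _ "insert x X"]) simp
  qed
qed

text \<open>
  This takes the place of Menger's theorem: if in an infinite locally finite graph only boundedly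
  large finite sets have at most \<open>k\<close> outer neighbours, then there are \<open>k + 1\<close> disjoint
  rays.
\<close>

lemma disjoint_rays_of_isoperimetry:
  assumes E: "parcs G \<subseteq> pverts G \<times> pverts G"
    and fin: "\<And>v. v \<in> pverts G \<Longrightarrow> finite (parcs G `` {v})"
    and inf: "infinite (pverts G)"
    and bound: "\<And>F. finite F \<Longrightarrow> F \<subseteq> pverts G \<Longrightarrow>
        card (closed_nbhd (parcs G) F) \<le> card F + k \<Longrightarrow> card F \<le> M"
  shows "\<exists>F. disjoint_rays_in (rays G) F \<and> card F = Suc k"
proof -
  obtain X where X: "finite X" "X \<subseteq> pverts G" "card X = Suc k"
    "hall (pverts G) (\<lambda>v. closed_nbhd (parcs G) {v} - X)"
    using exists_saturated_set[where j = "Suc k", OF E fin inf bound] by auto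
  obtain f where f: "inj_on f (pverts G)"
    "\<And>v. v \<in> pverts G \<Longrightarrow> f v \<in> closed_nbhd (parcs G) {v} - X"
    by (rule hall_infinite[OF X(4)]) (use fin in \<open>auto simp: closed_nbhd_def\<close>)
  have "X \<inter> f ` pverts G = {}" using f(2) by blast
  then show ?thesis
    using disjoint_rays_of_injection[OF E f(1) _ X(2)] f(2) X(3) by auto
qed

text \<open>
  The rays are grown greedily in turns: the vertices \<open>c n\<close> are chosen pairwise distinct
  with \<open>c (n + Suc k)\<close> adjacent to \<open>c n\<close>, and the rays follow the residue classes
  modulo \<open>Suc k\<close>.
\<close>

lemma disjoint_rays_infinite_degree:
  assumes E: "parcs G \<subseteq> pverts G \<times> pverts G"
    and deg: "\<And>v. v \<in> pverts G \<Longrightarrow> infinite (parcs G `` {v})"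
    and inf: "infinite (pverts G)"
  shows "\<exists>F. disjoint_rays_in (rays G) F \<and> card F = Suc k"
proof -
  let ?m = "Suc k"
  have "\<exists>c. \<forall>n. c n \<notin> c ` {..<n} \<and>
      c n \<in> (if n < ?m then pverts G else parcs G `` {c (n - ?m)})"
  proof (rule dependent_wellorder_choice)
    fix r :: 'a and f g :: "nat \<Rightarrow> 'a" and n
    assume "\<And>y. y < n \<Longrightarrow> f y = g y"
    then have "f ` {..<n} = g ` {..<n}" "\<not> n < ?m \<Longrightarrow> f (n - ?m) = g (n - ?m)" by auto
    then show "(r \<notin> f ` {..<n} \<and> r \<in> (if n < ?m then pverts G else parcs G `` {f (n - ?m)})) =
      (r \<notin> g ` {..<n} \<and> r \<in> (if n < ?m then pverts G else parcs G `` {g (n - ?m)}))"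
      by simp
  next
    fix n :: nat and f :: "nat \<Rightarrow> 'a"
    assume IH: "\<And>y. y < n \<Longrightarrow> f y \<notin> f ` {..<y} \<and>
      f y \<in> (if y < ?m then pverts G else parcs G `` {f (y - ?m)})"
    have V: "f y \<in> pverts G" if "y < n" for y
      using IH[OF that] E by (auto split: if_splits)
    let ?S = "if n < ?m then pverts G else parcs G `` {f (n - ?m)}"
    have "infinite ?S" using inf deg[OF V, of "n - ?m"] by simp
    then have "infinite (?S - f ` {..<n})" by (intro Diff_infinite_finite) auto
    then obtain r where "r \<in> ?S - f ` {..<n}" using infinite_imp_nonempty by blast
    then show "\<exists>r. r \<notin> f ` {..<n} \<and> r \<in> ?S" by blast
  qed
  then obtain c where new: "\<And>n. c n \<notin> c ` {..<n}"
    and nb: "\<And>n. c n \<in> (if n < ?m then pverts G else parcs G `` {c (n - ?m)})" by blast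
  have "inj c"
    using new by (intro linorder_injI) (metis imageI lessThan_iff)
  define \<rho> where "\<rho> j i = c (j + i * ?m)" for j i
  have eq: "j = j' \<and> i = i'" if "j < ?m" "j' < ?m" "\<rho> j i = \<rho> j' i'" for j j' i i'
  proof -
    have e: "j + i * ?m = j' + i' * ?m" using injD[OF \<open>inj c\<close>] that(3) by (simp add: \<rho>_def)
    have "j = (j + i * ?m) mod ?m" using that(1) by (simp only: mod_mult_self1 mod_less)
    also have "\<dots> = j'" using that(2) unfolding e by (simp only: mod_mult_self1 mod_less)
    finally have "j = j'" .
    with e have "i * ?m = i' * ?m" by linarith
    with \<open>j = j'\<close> show ?thesis unfolding mult_cancel2 by blast
  qed
  have ray: "\<rho> j \<in> rays G" if "j < ?m" for j
    unfolding rays_def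
  proof (intro CollectI conjI allI)
    show "inj (\<rho> j)" using eq[OF that that] by (auto intro: injI)
    fix i
    have "j + Suc i * ?m - ?m = j + i * ?m" "\<not> j + Suc i * ?m < ?m" by simp_all
    then show "(\<rho> j i, \<rho> j (Suc i)) \<in> parcs G"
      using nb[of "j + Suc i * ?m"] unfolding \<rho>_def by simp
  qed
  have "inj_on \<rho> {..<?m}"
    using eq by (intro inj_onI) (metis lessThan_iff)
  then have "card (\<rho> ` {..<?m}) = Suc k" by (simp add: card_image)
  moreover have "disjoint_rays_in (rays G) (\<rho> ` {..<?m})"
    unfolding disjoint_rays_in_def pairwise_def disjnt_def using ray eq by blast
  ultimately show ?thesis by blast
qed

section \<open>Balls and geodesic rays in locally finite graphs\<close>

text \<open>
  The set of vertices at distance at most \<open>n\<close> from the vertex set \<open>F\<close>. Statements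
  about distances are phrased as membership in balls.
\<close>

definition graph_ball :: "'a pair_pre_digraph \<Rightarrow> nat \<Rightarrow> 'a set \<Rightarrow> 'a set" where
  "graph_ball G n F = (closed_nbhd (parcs G) ^^ n) F"

text \<open>
  The action of an automorphism on the vertices; nothing is required of \<open>g\<close> outside the
  vertex set.
\<close>

definition vertex_automorphism :: "'a pair_pre_digraph \<Rightarrow> ('a \<Rightarrow> 'a) \<Rightarrow> bool" where
  "vertex_automorphism G g \<longleftrightarrow> bij_betw g (pverts G) (pverts G)
    \<and> (\<forall>x\<in>pverts G. \<forall>y\<in>pverts G. (g x, g y) \<in> parcs G \<longleftrightarrow> (x, y) \<in> parcs G)"

lemma graph_ball_0 [simp]: "graph_ball G 0 F = F"
  by (simp add: graph_ball_def)

lemma graph_ball_Suc: "graph_ball G (Suc n) F = closed_nbhd (parcs G) (graph_ball G n F)"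
  by (simp add: graph_ball_def)

lemma graph_ball_add: "graph_ball G (m + n) F = graph_ball G m (graph_ball G n F)"
  by (simp add: graph_ball_def funpow_add)

lemma graph_ball_mono: "F \<subseteq> F' \<Longrightarrow> graph_ball G n F \<subseteq> graph_ball G n F'"
  by (induction n) (auto simp: graph_ball_Suc intro!: closed_nbhd_mono)

lemma graph_ball_increasing: "m \<le> n \<Longrightarrow> graph_ball G m F \<subseteq> graph_ball G n F"
  by (rule lift_Suc_mono_le[of "\<lambda>n. graph_ball G n F"])
     (simp_all add: graph_ball_Suc subset_closed_nbhd)

lemma graph_ball_increasingD:
  "u \<in> graph_ball G m F \<Longrightarrow> m \<le> n \<Longrightarrow> u \<in> graph_ball G n F"
  using graph_ball_increasing[of m n G F] by blast

lemma graph_ball_UN: "graph_ball G n F = (\<Union>v\<in>F. graph_ball G n {v})"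
  by (induction n) (auto simp: graph_ball_Suc closed_nbhd_def)

lemma graph_ball_trans:
  "u \<in> graph_ball G m {v} \<Longrightarrow> v \<in> graph_ball G n F \<Longrightarrow> u \<in> graph_ball G (m + n) F"
  using graph_ball_mono[of "{v}" "graph_ball G n F" G m] by (auto simp: graph_ball_add)

lemma graph_ball_subset_of_disjoint_boundary:
  assumes "w \<in> F" "graph_ball G n {w} \<inter> (closed_nbhd (parcs G) F - F) = {}"
  shows "graph_ball G n {w} \<subseteq> F"
  using assms(2)
proof (induction n)
  case 0
  then show ?case using assms(1) by simp
next
  case (Suc n)
  have "graph_ball G n {w} \<subseteq> graph_ball G (Suc n) {w}" by (rule graph_ball_increasing) simp
  then have "graph_ball G n {w} \<subseteq> F" using Suc by blast
  then have "graph_ball G (Suc n) {w} \<subseteq> closed_nbhd (parcs G) F"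
    by (simp add: graph_ball_Suc closed_nbhd_mono)
  then show ?case using Suc.prems by blast
qed

text \<open>
  Connected graphs in which every vertex has finitely many neighbours; the vertex set may be
  finite or infinite, and loops do no harm.
\<close>

locale connected_locally_finite =
  fixes G :: "'a pair_pre_digraph"
  assumes arcs_subset: "parcs G \<subseteq> pverts G \<times> pverts G"
    and sym_arcs: "sym (parcs G)"
    and connected: "\<And>u v. u \<in> pverts G \<Longrightarrow> v \<in> pverts G \<Longrightarrow> (u, v) \<in> (parcs G)\<^sup>*"
    and locally_finite: "\<And>v. v \<in> pverts G \<Longrightarrow> finite (parcs G `` {v})"
begin

abbreviation V where "V \<equiv> pverts G"
abbreviation E where "E \<equiv> parcs G"
abbreviation cball where "cball \<equiv> graph_ball G"

lemma closed_nbhd_subset: "F \<subseteq> V \<Longrightarrow> closed_nbhd E F \<subseteq> V"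
  using arcs_subset by (auto simp: closed_nbhd_def)

lemma finite_closed_nbhd: "finite F \<Longrightarrow> F \<subseteq> V \<Longrightarrow> finite (closed_nbhd E F)"
proof -
  assume "finite F" "F \<subseteq> V"
  moreover have "closed_nbhd E F = F \<union> (\<Union>v\<in>F. E `` {v})" by (auto simp: closed_nbhd_def)
  ultimately show ?thesis using locally_finite by auto
qed

lemma cball_subset: "F \<subseteq> V \<Longrightarrow> cball n F \<subseteq> V"
  by (induction n) (simp_all add: graph_ball_Suc closed_nbhd_subset)

lemma finite_cball: "finite F \<Longrightarrow> F \<subseteq> V \<Longrightarrow> finite (cball n F)"
  by (induction n) (simp_all add: graph_ball_Suc finite_closed_nbhd cball_subset)

lemma cball_sym: "u \<in> cball n {v} \<Longrightarrow> v \<in> cball n {u}"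
proof (induction n arbitrary: u)
  case (Suc n)
  then obtain w where w: "w \<in> cball n {v}" "u \<in> closed_nbhd E {w}"
    by (auto simp: graph_ball_Suc closed_nbhd_def)
  then have "w \<in> cball (Suc 0) {u}"
    using sym_arcs by (auto simp: graph_ball_Suc closed_nbhd_def sym_def)
  with Suc.IH[OF w(1)] have "v \<in> cball (n + Suc 0) {u}" by (rule graph_ball_trans)
  then show ?case by simp
qed simp

lemma cball_exhaust:
  assumes "u \<in> V" "v \<in> V" shows "\<exists>n. u \<in> cball n {v}"
  using connected[OF assms(2,1)]
proof (induction rule: rtrancl_induct)
  case base
  show ?case by (rule exI[of _ 0]) simp
next
  case (step y z)
  then obtain n where "y \<in> cball n {v}" by blast
  with step(2) have "z \<in> cball (Suc n) {v}" by (auto simp: graph_ball_Suc closed_nbhd_def)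
  then show ?case by blast
qed

lemma cball_cover_finite:
  assumes "finite F" "F \<subseteq> V" "v \<in> V" shows "\<exists>n. F \<subseteq> cball n {v}"
  using assms(1,2)
proof (induction F)
  case (insert x F)
  then obtain n where n: "F \<subseteq> cball n {v}" by auto
  obtain m where m: "x \<in> cball m {v}" using cball_exhaust insert.prems assms(3) by blast
  have "cball n {v} \<subseteq> cball (max m n) {v}" "cball m {v} \<subseteq> cball (max m n) {v}"
    by (simp_all add: graph_ball_increasing)
  with n m show ?case by (intro exI[of _ "max m n"]) auto
qed simp

lemma ex_large_cball:
  assumes "infinite V" "v \<in> V" shows "\<exists>n. m \<le> card (cball n {v})"
proof -
  obtain F where "F \<subseteq> V" "finite F" "card F = m"
    using infinite_arbitrarily_large[OF assms(1)] by metis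
  moreover then obtain n where "F \<subseteq> cball n {v}" using cball_cover_finite assms(2) by blast
  ultimately show ?thesis using finite_cball[of "{v}" n] assms(2) by (metis card_mono empty_subsetI finite.emptyI finite_insert insert_subset)
qed

lemma closed_nbhd_automorphism:
  assumes g: "vertex_automorphism G g" and F: "F \<subseteq> V"
  shows "closed_nbhd E (g ` F) = g ` closed_nbhd E F"
proof -
  have bij: "g ` V = V" and iff: "\<And>x y. x \<in> V \<Longrightarrow> y \<in> V \<Longrightarrow> (g x, g y) \<in> E \<longleftrightarrow> (x, y) \<in> E"
    using g by (auto simp: vertex_automorphism_def bij_betw_def)
  have "E `` (g ` F) = g ` (E `` F)"
  proof (intro equalityI subsetI)
    fix z assume "z \<in> E `` (g ` F)"
    then obtain x where x: "x \<in> F" "(g x, z) \<in> E" by blast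
    then obtain y where "y \<in> V" "z = g y" using arcs_subset bij by blast
    with x iff F show "z \<in> g ` (E `` F)" by blast
  next
    fix z assume "z \<in> g ` (E `` F)"
    then obtain x y where "x \<in> F" "(x, y) \<in> E" "z = g y" by blast
    with iff arcs_subset show "z \<in> E `` (g ` F)" by blast
  qed
  then show ?thesis by (simp add: closed_nbhd_def image_Un)
qed

lemma cball_automorphism:
  assumes g: "vertex_automorphism G g" and F: "F \<subseteq> V"
  shows "cball n (g ` F) = g ` cball n F"
  by (induction n)
     (simp_all add: graph_ball_Suc closed_nbhd_automorphism[OF g cball_subset[OF F]])

lemma inj_on_automorphism: "vertex_automorphism G g \<Longrightarrow> inj_on g V"
  and automorphism_in_V: "vertex_automorphism G g \<Longrightarrow> v \<in> V \<Longrightarrow> g v \<in> V"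
  by (auto simp: vertex_automorphism_def bij_betw_def)

lemma cball_automorphism_iff:
  assumes g: "vertex_automorphism G g" and "u \<in> V" "v \<in> V"
  shows "g u \<in> cball n {g v} \<longleftrightarrow> u \<in> cball n {v}"
  using cball_automorphism[OF g, of "{v}" n] inj_on_automorphism[OF g] cball_subset[of "{v}" n] assms
  by (auto simp: inj_on_image_mem_iff)

text \<open>
  A Koenig argument on geodesics from \<open>N\<close>: if an infinite set \<open>U\<close> is
  attached to the rest of the graph only through the finite set \<open>N\<close>, then a ray starts
  in \<open>N\<close> and moves away from \<open>N\<close> at unit speed inside \<open>U\<close>. For \<open>N\<close> a single vertex and \<open>U\<close> all the
  others this gives a geodesic ray, for other sets a ray that is separated from the outside.
\<close>

lemma koenig_geodesic:
  assumes N: "finite N" "N \<noteq> {}" "N \<subseteq> V" and U: "infinite U" "U \<subseteq> V" "N \<inter> U = {}"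
    and nb: "E `` U \<subseteq> U \<union> N"
  shows "\<exists>r \<in> rays G. r 0 \<in> N \<and> (\<forall>n. r (Suc n) \<in> U)
    \<and> (\<forall>n. r n \<in> cball n N) \<and> (\<forall>m n. m < n \<longrightarrow> r n \<notin> cball m N)"
proof -
  define S where "S n = cball n N - (\<Union>m<n. cball m N)" for n
  \<comment> \<open>Arcs into \<open>U\<close> that lead from one distance sphere around \<open>N\<close> to the next.\<close>
  define A where "A = {(x, y). (x, y) \<in> E \<and> y \<in> U \<and> (\<exists>n. x \<in> S n \<and> y \<in> S (Suc n))}"
  have S_unique: "m = n" if "x \<in> S m" "x \<in> S n" for x m n
    using that by (cases m n rule: linorder_cases) (auto simp: S_def)
  have reach: "\<exists>x\<in>N. (x, y) \<in> A\<^sup>*" if "y \<in> S n" "y \<in> N \<union> U" for n y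
    using that
  proof (induction n arbitrary: y)
    case 0
    then show ?case by (auto simp: S_def)
  next
    case (Suc n)
    have sub: "cball m N \<subseteq> cball n N" if "m \<le> n" for m
      using that by (rule graph_ball_increasing)
    have y: "y \<in> cball (Suc n) N" "y \<notin> cball m N" if "m \<le> n" for m
      using Suc.prems(1) that by (auto simp: S_def)
    then have "y \<notin> N" using y(2)[of 0] by simp
    then have yU: "y \<in> U" using Suc.prems by blast
    obtain x where x: "x \<in> cball n N" "(x, y) \<in> E"
      using y[of n] by (auto simp: graph_ball_Suc closed_nbhd_def)
    have "x \<notin> cball m N" if "m < n" for m
    proof
      assume "x \<in> cball m N"
      then have "y \<in> cball (Suc m) N" using x(2) by (auto simp: graph_ball_Suc closed_nbhd_def)
      then show False using y(2)[of "Suc m"] that by simp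
    qed
    with x have xS: "x \<in> S n" by (auto simp: S_def)
    have "(y, x) \<in> E" using x(2) sym_arcs by (auto simp: sym_def)
    then have "x \<in> N \<union> U" using nb yU by blast
    then obtain z where "z \<in> N" "(z, x) \<in> A\<^sup>*" using Suc.IH[OF xS] by blast
    moreover have "(x, y) \<in> A" using x yU xS Suc.prems by (auto simp: A_def)
    ultimately show ?case by (meson rtrancl.rtrancl_into_rtrancl)
  qed
  have "U \<subseteq> (\<Union>x\<in>N. A\<^sup>* `` {x})"
  proof
    fix y assume y: "y \<in> U"
    obtain x where x: "x \<in> N" using N by blast
    then obtain n where "y \<in> cball n {x}" using cball_exhaust[of y x] y U(2) N(3) by blast
    then have ex: "\<exists>n. y \<in> cball n N" using graph_ball_mono[of "{x}" N G n] x by blast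
    define n where "n = (LEAST n. y \<in> cball n N)"
    have "y \<in> S n"
      using LeastI_ex[OF ex] not_less_Least[of _ "\<lambda>n. y \<in> cball n N"] by (auto simp: S_def n_def)
    then show "y \<in> (\<Union>x\<in>N. A\<^sup>* `` {x})" using reach y by blast
  qed
  then obtain x0 where x0: "x0 \<in> N" "infinite (A\<^sup>* `` {x0})"
    using U(1) N(1) by (meson finite_UN finite_subset)
  \<comment> \<open>A vertex has finitely many successors, so one of them inherits the infinite reach.\<close>
  have step: "\<exists>y. (x, y) \<in> A \<and> infinite (A\<^sup>* `` {y})" if "infinite (A\<^sup>* `` {x})" "x \<in> V" for x
  proof (rule ccontr)
    assume c: "\<not> ?thesis"
    have "A\<^sup>* `` {x} \<subseteq> insert x (\<Union>y\<in>A `` {x}. A\<^sup>* `` {y})"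
      by (auto elim: converse_rtranclE)
    moreover have "finite (A `` {x})"
      by (rule finite_subset[OF _ locally_finite[OF that(2)]]) (auto simp: A_def)
    ultimately have "finite (A\<^sup>* `` {x})"
      using c by (meson Image_singleton_iff finite_UN finite_insert finite_subset)
    with that show False by blast
  qed
  have "\<exists>r. \<forall>n. ((r n \<in> V \<and> infinite (A\<^sup>* `` {r n})) \<and> (n = 0 \<longrightarrow> r n = x0))
      \<and> (r n, r (Suc n)) \<in> A"
  proof (rule dependent_nat_choice)
    show "\<exists>x. (x \<in> V \<and> infinite (A\<^sup>* `` {x})) \<and> (0 = (0::nat) \<longrightarrow> x = x0)"
      using x0 N by blast
  next
    fix x and n :: nat assume "(x \<in> V \<and> infinite (A\<^sup>* `` {x})) \<and> (n = 0 \<longrightarrow> x = x0)"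
    then obtain y where y: "(x, y) \<in> A" "infinite (A\<^sup>* `` {y})" using step by blast
    then have "y \<in> V" using arcs_subset by (auto simp: A_def)
    with y show "\<exists>y. ((y \<in> V \<and> infinite (A\<^sup>* `` {y})) \<and> (Suc n = 0 \<longrightarrow> y = x0)) \<and> (x, y) \<in> A"
      by blast
  qed
  then obtain r where r0: "r 0 = x0" and rA: "\<And>n. (r n, r (Suc n)) \<in> A" by blast
  have rS: "r n \<in> S n" for n
  proof (induction n)
    case 0
    then show ?case using r0 x0 by (simp add: S_def)
  next
    case (Suc n)
    obtain m where "r n \<in> S m" "r (Suc n) \<in> S (Suc m)" using rA[of n] by (auto simp: A_def)
    then show ?case using S_unique[OF Suc] by blast
  qed
  have "inj r"
  proof (rule injI)
    fix i j assume "r i = r j"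
    then show "i = j" using S_unique[OF rS[of i]] rS[of j] by simp
  qed
  moreover have "(r i, r (Suc i)) \<in> E" for i using rA[of i] by (simp add: A_def)
  ultimately have "r \<in> rays G" by (simp add: rays_def)
  moreover have "r (Suc n) \<in> U" for n using rA by (auto simp: A_def)
  moreover have "r n \<in> cball n N" "m < n \<Longrightarrow> r n \<notin> cball m N" for m n
    using rS[of n] by (auto simp: S_def)
  ultimately show ?thesis using r0 x0 by blast
qed

end

section \<open>Large sets with few outer neighbours in transitive graphs\<close>

text \<open>Infinite such graphs with a vertex-transitive automorphism group.\<close>

locale transitive_locally_finite = connected_locally_finite +
  assumes infinite_V: "infinite V"
    and transitive: "\<And>u v. u \<in> V \<Longrightarrow> v \<in> V \<Longrightarrow> \<exists>g. vertex_automorphism G g \<and> g u = v"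
begin

lemma card_cball_eq:
  assumes "u \<in> V" "v \<in> V" shows "card (cball n {u}) = card (cball n {v})"
proof -
  obtain g where g: "vertex_automorphism G g" "g u = v" using transitive assms by blast
  have "cball n {v} = g ` cball n {u}" using cball_automorphism[OF g(1), of "{u}" n] g(2) assms by simp
  moreover have "inj_on g (cball n {u})"
    using inj_on_automorphism[OF g(1)] cball_subset[of "{u}" n] assms by (auto intro: inj_on_subset)
  ultimately show ?thesis by (simp add: card_image)
qed

lemma ray_in_V: "r \<in> rays G \<Longrightarrow> r i \<in> V"
  using arcs_subset by (auto simp: rays_def)

lemma ray_cball: "r \<in> rays G \<Longrightarrow> r (i + d) \<in> cball d {r i}"
proof (induction d)
  case (Suc d)
  then have "(r (i + d), r (i + Suc d)) \<in> E" by (simp add: rays_def)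
  then show ?case using Suc by (auto simp: graph_ball_Suc closed_nbhd_def)
qed simp

lemma ex_geodesic_ray:
  assumes "v \<in> V"
  shows "\<exists>r \<in> rays G. r 0 = v \<and> (\<forall>m n. r n \<in> cball m {v} \<longrightarrow> n \<le> m)"
proof -
  have "E `` (V - {v}) \<subseteq> (V - {v}) \<union> {v}" using arcs_subset by blast
  then obtain r where "r \<in> rays G" "r 0 \<in> {v}" "\<forall>m n. m < n \<longrightarrow> r n \<notin> cball m {v}"
    using koenig_geodesic[of "{v}" "V - {v}"] assms infinite_V by auto
  then show ?thesis by (intro bexI[of _ r]) (auto simp: not_less[symmetric])
qed

text \<open>
  A transitive graph is not within bounded distance \<open>D\<close> of a geodesic ray. Indeed,
  translate the middle vertex of the initial segment of length \<open>2n\<close> to the origin of the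
  ray. The images of the two ends of the segment lie at distance \<open>n\<close> from the origin; being
  \<open>D\<close>-close to the ray they are both \<open>2D\<close>-close to its \<open>n\<close>-th vertex,
  although they have distance \<open>2n > 4D\<close> from each other.
\<close>

lemma geodesic_ray_not_cobounded:
  assumes R: "R \<in> rays G" and geo: "\<And>m n. R n \<in> cball m {R 0} \<Longrightarrow> n \<le> m"
  shows "\<exists>x\<in>V. \<forall>i. x \<notin> cball D {R i}"
proof (rule ccontr)
  assume "\<not> ?thesis"
  then have cov: "\<exists>i. x \<in> cball D {R i}" if "x \<in> V" for x using that by blast
  note RV = ray_in_V[OF R]
  define n where "n = Suc (2 * D)"
  obtain g where g: "vertex_automorphism G g" "g (R n) = R 0" using transitive RV by blast
  note iff = cball_automorphism_iff[OF g(1)]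
  have near: "g y \<in> cball (D + D) {R n}"
    if y: "y \<in> V" "y \<in> cball n {R n}" "\<And>j. y \<in> cball j {R n} \<Longrightarrow> n \<le> j" for y
  proof -
    have gy: "g y \<in> V" using automorphism_in_V[OF g(1) y(1)] .
    then obtain i where i: "g y \<in> cball D {R i}" using cov by blast
    have "g y \<in> cball n {R 0}" using iff[OF y(1) RV, of n n] y(2) g(2) by simp
    with cball_sym[OF i] have "R i \<in> cball (D + n) {R 0}" by (rule graph_ball_trans)
    then have upper: "i \<le> D + n" by (rule geo)
    have "R i \<in> cball i {R 0}" using ray_cball[OF R, of 0 i] by simp
    with i have "g y \<in> cball (D + i) {R 0}" by (rule graph_ball_trans)
    then have "y \<in> cball (D + i) {R n}" using iff[OF y(1) RV, of "D + i" n] g(2) by simp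
    then have lower: "n \<le> D + i" by (rule y(3))
    have "R i \<in> cball D {R n}"
    proof (cases "n \<le> i")
      case True
      then have "R i \<in> cball (i - n) {R n}" using ray_cball[OF R, of n "i - n"] by simp
      moreover have "i - n \<le> D" using upper by simp
      ultimately show ?thesis by (rule graph_ball_increasingD)
    next
      case False
      then have "R n \<in> cball (n - i) {R i}" using ray_cball[OF R, of i "n - i"] by simp
      moreover have "n - i \<le> D" using lower by simp
      ultimately have "R n \<in> cball D {R i}" by (rule graph_ball_increasingD)
      then show ?thesis by (rule cball_sym)
    qed
    with i show ?thesis by (rule graph_ball_trans)
  qed
  have near0: "g (R 0) \<in> cball (D + D) {R n}"
  proof (rule near[OF RV])
    show "R 0 \<in> cball n {R n}" using cball_sym[OF ray_cball[OF R, of 0 n]] by simp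
    show "n \<le> j" if "R 0 \<in> cball j {R n}" for j using geo[OF cball_sym[OF that]] .
  qed
  have "g (R (n + n)) \<in> cball (D + D) {R n}"
  proof (rule near[OF RV])
    show "R (n + n) \<in> cball n {R n}" by (rule ray_cball[OF R])
    show "n \<le> j" if "R (n + n) \<in> cball j {R n}" for j
    proof -
      have "R n \<in> cball n {R 0}" using ray_cball[OF R, of 0 n] by simp
      with that have "R (n + n) \<in> cball (j + n) {R 0}" by (rule graph_ball_trans)
      then have "n + n \<le> j + n" by (rule geo)
      then show ?thesis by simp
    qed
  qed
  then have "g (R (n + n)) \<in> cball (D + D + (D + D)) {g (R 0)}"
    using cball_sym[OF near0] by (rule graph_ball_trans)
  then have "R (n + n) \<in> cball (D + D + (D + D)) {R 0}" using iff[OF RV RV] by blast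
  then have "n + n \<le> D + D + (D + D)" by (rule geo)
  then show False by (simp add: n_def)
qed

text \<open>
  If there are arbitrarily large finite sets with at most \<open>k\<close> outer neighbours, then the
  graph has two rays separated by a finite set. For the least such number \<open>K\<close>, all large
  finite sets have at least \<open>K\<close> outer neighbours. Take one with exactly \<open>K\<close> that
  contains a big ball, and let \<open>A v\<close> be a translate of it containing the ball around
  \<open>v\<close>. If \<open>v\<close> and \<open>v'\<close> are adjacent, then \<open>A v \<inter> A v'\<close> is large, so by
  submodularity the union of the \<open>A v\<close> along a path still has at most \<open>K\<close> outer
  neighbours. Hence so does their union \<open>U\<close> along a geodesic ray. As \<open>U\<close> stays close to
  this ray, its complement is infinite and contains another ray.
\<close>

lemma separated_rays:
  assumes small_boundary: "\<And>M. \<exists>F. finite F \<and> F \<subseteq> V \<and> card (closed_nbhd E F) \<le> card F + k \<and> M < card F"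
  shows "\<exists>R \<in> rays G. \<exists>s \<in> rays G. \<exists>U. U \<subseteq> V \<and> finite (closed_nbhd E U - U)
    \<and> range R \<subseteq> U \<and> range s \<inter> closed_nbhd E U = {}"
proof -
  let ?N = "closed_nbhd E"
  define thin where "thin j \<longleftrightarrow> (\<forall>M. \<exists>F. finite F \<and> F \<subseteq> V \<and> card (?N F) \<le> card F + j \<and> M < card F)" for j
  define K where "K = (LEAST j. thin j)"
  have "thin k" using small_boundary by (simp add: thin_def)
  then have thinK: "thin K" unfolding K_def by (rule LeastI)
  have "\<exists>m. \<forall>F. finite F \<and> F \<subseteq> V \<and> m \<le> card F \<longrightarrow> card F + K \<le> card (?N F)"
  proof (cases K)
    case 0
    then show ?thesis
      by (intro exI[of _ 0]) (simp add: card_mono finite_closed_nbhd subset_closed_nbhd)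
  next
    case (Suc j)
    then have "\<not> thin j" unfolding K_def by (intro not_less_Least) simp
    then obtain M where M: "\<And>F. finite F \<Longrightarrow> F \<subseteq> V \<Longrightarrow> card (?N F) \<le> card F + j \<Longrightarrow> card F \<le> M"
      unfolding thin_def by (meson not_less)
    show ?thesis
    proof (intro exI[of _ "Suc M"] allI impI)
      fix F assume "finite F \<and> F \<subseteq> V \<and> Suc M \<le> card F"
      with M[of F] Suc show "card F + K \<le> card (?N F)" by linarith
    qed
  qed
  then obtain m where large: "\<And>F. finite F \<Longrightarrow> F \<subseteq> V \<Longrightarrow> m \<le> card F \<Longrightarrow> card F + K \<le> card (?N F)"
    by blast
  obtain a where a: "a \<in> V" using infinite_V infinite_imp_nonempty by blast
  obtain q where "m \<le> card (cball q {a})" using ex_large_cball[OF infinite_V a] by blast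
  then have q: "m \<le> card (cball q {v})" if "v \<in> V" for v using card_cball_eq[OF that a] by simp
  \<comment> \<open>A set with more than \<open>K * b\<close> vertices is not covered by the balls around its outer
    neighbours, hence contains a ball of radius \<open>Suc q\<close>. The extra step beyond \<open>q\<close> makes
    the translates at adjacent vertices share a ball of radius \<open>q\<close>.\<close>
  define b where "b = card (cball (Suc q) {a})"
  obtain F where F: "finite F" "F \<subseteq> V" "card (?N F) \<le> card F + K" "K * b < card F"
    using thinK unfolding thin_def by blast
  define B where "B = ?N F - F"
  have B: "finite B" "B \<subseteq> V" using F finite_closed_nbhd closed_nbhd_subset by (auto simp: B_def)
  have "card B = card (?N F) - card F" unfolding B_def by (rule card_Diff_subset[OF F(1) subset_closed_nbhd])
  then have "card B \<le> K" using F(3) by simp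
  have "card (cball (Suc q) B) \<le> (\<Sum>v\<in>B. card (cball (Suc q) {v}))"
    unfolding graph_ball_UN[of G "Suc q" B] by (rule card_UN_le[OF B(1)])
  also have "\<dots> = card B * b" using card_cball_eq[OF _ a, of _ "Suc q"] B(2) by (simp add: b_def subset_eq)
  also have "\<dots> \<le> K * b" using \<open>card B \<le> K\<close> by simp
  finally have "card (cball (Suc q) B) < card F" using F(4) by simp
  then have "\<not> F \<subseteq> cball (Suc q) B" using card_mono[OF finite_cball[OF B]] not_less by blast
  then obtain w where w: "w \<in> F" "w \<notin> cball (Suc q) B" by blast
  have "cball (Suc q) {w} \<inter> B = {}"
    using w(2) cball_sym graph_ball_mono[of "{_}" B G "Suc q"] by blast
  then have wF: "cball (Suc q) {w} \<subseteq> F"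
    unfolding B_def by (intro graph_ball_subset_of_disjoint_boundary[OF w(1)])
  have wV: "w \<in> V" using w F by blast
  obtain D where D: "F \<subseteq> cball D {w}" using cball_cover_finite[OF F(1,2) wV] by blast
  have "\<forall>v\<in>V. \<exists>A. finite A \<and> A \<subseteq> V \<and> card (?N A) \<le> card A + K
      \<and> cball (Suc q) {v} \<subseteq> A \<and> A \<subseteq> cball D {v}"
  proof
    fix v assume "v \<in> V"
    then obtain g where g: "vertex_automorphism G g" "g w = v" using transitive wV by blast
    have inj: "inj_on g A" if "A \<subseteq> V" for A
      using inj_on_automorphism[OF g(1)] that by (rule inj_on_subset)
    have ball: "cball n {v} = g ` cball n {w}" for n
      using cball_automorphism[OF g(1), of "{w}" n] wV g(2) by simp
    have "card (?N (g ` F)) = card (?N F)"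
      using closed_nbhd_automorphism[OF g(1) F(2)] inj[OF closed_nbhd_subset[OF F(2)]]
      by (simp add: card_image)
    then have "card (?N (g ` F)) \<le> card (g ` F) + K" using F(3) inj[OF F(2)] by (simp add: card_image)
    moreover have "g ` F \<subseteq> V" using automorphism_in_V[OF g(1)] F(2) by blast
    ultimately show "\<exists>A. finite A \<and> A \<subseteq> V \<and> card (?N A) \<le> card A + K
        \<and> cball (Suc q) {v} \<subseteq> A \<and> A \<subseteq> cball D {v}"
      using F(1) wF D ball by (intro exI[of _ "g ` F"]) auto
  qed
  then obtain A where A: "\<And>v. v \<in> V \<Longrightarrow> finite (A v)" "\<And>v. v \<in> V \<Longrightarrow> A v \<subseteq> V"
    "\<And>v. v \<in> V \<Longrightarrow> card (?N (A v)) \<le> card (A v) + K"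
    "\<And>v. v \<in> V \<Longrightarrow> cball (Suc q) {v} \<subseteq> A v" "\<And>v. v \<in> V \<Longrightarrow> A v \<subseteq> cball D {v}"
    by metis
  obtain R where R: "R \<in> rays G" "R 0 = w" and geo: "\<And>m n. R n \<in> cball m {R 0} \<Longrightarrow> n \<le> m"
    using ex_geodesic_ray[OF wV] by auto
  note RV = ray_in_V[OF R(1)]
  have centre: "v \<in> A v" if "v \<in> V" for v
    using A(4)[OF that] graph_ball_increasing[of 0 "Suc q" G "{v}"] by auto
  define P where "P n = (\<Union>i\<le>n. A (R i))" for n
  have P: "finite (P n)" "P n \<subseteq> V" for n using A(1,2) RV by (auto simp: P_def)
  have P_thin: "card (?N (P n)) \<le> card (P n) + K" for n
  proof (induction n)
    case 0
    then show ?case using A(3)[OF RV] by (simp add: P_def)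
  next
    case (Suc n)
    let ?A = "A (R (Suc n))"
    have PS: "P (Suc n) = P n \<union> ?A" by (auto simp: P_def le_Suc_eq)
    have fin: "finite ?A" "?A \<subseteq> V" using A(1,2) RV by auto
    have "cball q {R n} \<subseteq> A (R n)"
      using A(4)[OF RV, of n] graph_ball_increasing[of q "Suc q" G "{R n}"] by auto
    moreover have "cball q {R n} \<subseteq> ?A"
    proof
      fix x assume x: "x \<in> cball q {R n}"
      have "R n \<in> cball 1 {R (Suc n)}" using cball_sym[OF ray_cball[OF R(1), of n 1]] by simp
      with x have "x \<in> cball (q + 1) {R (Suc n)}" by (rule graph_ball_trans)
      then show "x \<in> ?A" using A(4)[OF RV, of "Suc n"] by auto
    qed
    ultimately have "cball q {R n} \<subseteq> P n \<inter> ?A" by (auto simp: P_def)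
    then have "card (cball q {R n}) \<le> card (P n \<inter> ?A)" using fin by (intro card_mono) auto
    then have int: "card (P n \<inter> ?A) + K \<le> card (?N (P n \<inter> ?A))"
      using q[OF RV, of n] fin by (intro large) auto
    have "card (?N (P n \<union> ?A)) + card (?N (P n \<inter> ?A)) \<le> card (?N (P n)) + card (?N ?A)"
      using card_closed_nbhd_submodular[of E "P n" "{}" ?A] finite_closed_nbhd P fin by simp
    moreover have "card (P n) + card ?A = card (P n \<union> ?A) + card (P n \<inter> ?A)"
      by (rule card_Un_Int[OF P(1) fin(1)])
    ultimately show ?case using int Suc.IH A(3)[OF RV, of "Suc n"] unfolding PS by linarith
  qed
  define U where "U = (\<Union>i. A (R i))"
  have UV: "U \<subseteq> V" using A(2) RV by (auto simp: U_def)
  \<comment> \<open>Finitely many outer neighbours of \<open>U\<close> are outer neighbours of some \<open>P n\<close> already.\<close>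
  have "card T \<le> K" if T: "T \<subseteq> ?N U - U" "finite T" for T
  proof -
    have "\<exists>n. t \<in> ?N (P n)" if "t \<in> T" for t
    proof -
      have "?N U = (\<Union>i. ?N (A (R i)))" unfolding U_def closed_nbhd_def by blast
      then obtain i where i: "t \<in> ?N (A (R i))" using T(1) \<open>t \<in> T\<close> by auto
      have "A (R i) \<subseteq> P i" by (auto simp: P_def)
      with i closed_nbhd_mono show ?thesis by blast
    qed
    then obtain f where f: "\<And>t. t \<in> T \<Longrightarrow> t \<in> ?N (P (f t))" by metis
    obtain n where n: "\<And>t. t \<in> T \<Longrightarrow> f t \<le> n"
      using finite_imageI[OF T(2), of f] by (auto simp: finite_nat_set_iff_bounded_le)
    have "P i \<subseteq> P n" if "i \<le> n" for i using that by (force simp: P_def)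
    then have "T \<subseteq> ?N (P n)" using f n closed_nbhd_mono by blast
    moreover have "T \<inter> P n = {}" using T(1) by (auto simp: P_def U_def)
    ultimately have "card T \<le> card (?N (P n) - P n)"
      using finite_closed_nbhd[OF P] by (intro card_mono) auto
    also have "\<dots> = card (?N (P n)) - card (P n)" by (rule card_Diff_subset[OF P(1) subset_closed_nbhd])
    finally show ?thesis using P_thin[of n] by linarith
  qed
  then have fin_bd: "finite (?N U - U)" using finite_if_finite_subsets_card_bdd by blast
  have inf: "infinite (V - ?N U)"
  proof
    assume "finite (V - ?N U)"
    then have "finite ((V - ?N U) \<union> (?N U - U))" using fin_bd by blast
    then have "finite (V - U)" by (rule rev_finite_subset) blast
    then obtain d where d: "V - U \<subseteq> cball d {w}" using cball_cover_finite wV by blast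
    obtain x where x: "x \<in> V" "\<And>i. x \<notin> cball (max D d) {R i}"
      using geodesic_ray_not_cobounded[OF R(1) geo] by blast
    have "cball D {R i} \<subseteq> cball (max D d) {R i}" "cball d {R i} \<subseteq> cball (max D d) {R i}" for i
      by (simp_all add: graph_ball_increasing)
    then have "x \<notin> cball D {R i}" "x \<notin> cball d {R i}" for i using x(2) by blast+
    moreover from this(2)[of 0] have "x \<in> U" using d x(1) R(2) by blast
    then obtain i where "x \<in> A (R i)" by (auto simp: U_def)
    then have "x \<in> cball D {R i}" using A(5)[OF RV] by blast
    ultimately show False by blast
  qed
  have RU: "range R \<subseteq> U" using centre RV by (auto simp: U_def)
  \<comment> \<open>The vertex \<open>w\<close> is added only to make the finite set nonempty.\<close>
  let ?B = "insert w (?N U - U)" and ?W = "V - ?N U"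
  have "w \<in> ?N U" using RU R(2) subset_closed_nbhd[of U E] by blast
  moreover have "E `` ?W \<subseteq> ?W \<union> ?B"
  proof
    fix y assume "y \<in> E `` ?W"
    then obtain x where x: "x \<in> V" "x \<notin> ?N U" "(x, y) \<in> E" by blast
    have "y \<notin> U"
    proof
      assume "y \<in> U"
      then have "x \<in> ?N U" using symD[OF sym_arcs x(3)] by (auto simp: closed_nbhd_def)
      with x show False by blast
    qed
    then show "y \<in> ?W \<union> ?B" using x(3) arcs_subset by blast
  qed
  moreover have "?B \<subseteq> V" using closed_nbhd_subset[OF UV] wV by blast
  ultimately have "\<exists>s \<in> rays G. s 0 \<in> ?B \<and> (\<forall>n. s (Suc n) \<in> ?W)
      \<and> (\<forall>n. s n \<in> cball n ?B) \<and> (\<forall>m n. m < n \<longrightarrow> s n \<notin> cball m ?B)"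
    using fin_bd inf by (intro koenig_geodesic) blast+
  then obtain s where s: "s \<in> rays G" "\<And>n. s (Suc n) \<in> ?W" by blast
  have "(\<lambda>n. s (Suc n)) \<in> rays G" using s(1) by (auto simp: rays_def inj_def)
  moreover have "range (\<lambda>n. s (Suc n)) \<inter> ?N U = {}" using s(2) by blast
  ultimately show ?thesis using R(1) RU UV fin_bd by blast
qed

end

section \<open>Automorphisms, ends and connectedness\<close>

lemma vertex_automorphism_iso_verts:
  assumes wf: "parcs G \<subseteq> pverts G \<times> pverts G" and \<phi>: "graph_automorphism G \<phi>"
  shows "vertex_automorphism G (iso_verts \<phi>)"
proof -
  have iso: "pre_digraph.digraph_isomorphism (with_proj G) \<phi>"
    and app: "app_iso \<phi> (with_proj G) = with_proj G"
    using \<phi> by (auto simp: graph_automorphism_def)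
  have img: "iso_verts \<phi> ` pverts G = pverts G" "iso_arcs \<phi> ` parcs G = parcs G"
    and proj: "iso_tail \<phi> = fst" "iso_head \<phi> = snd"
    using arg_cong[OF app, of verts] arg_cong[OF app, of arcs]
      arg_cong[OF app, of tail] arg_cong[OF app, of head] by simp_all
  have inj: "inj_on (iso_verts \<phi>) (pverts G)"
    using iso by (simp add: pre_digraph.digraph_isomorphism_def)
  have arc: "iso_arcs \<phi> (x, y) = (iso_verts \<phi> x, iso_verts \<phi> y)" if "(x, y) \<in> parcs G" for x y
    using iso that by (auto simp: pre_digraph.digraph_isomorphism_def proj intro!: prod_eqI)
  have "(iso_verts \<phi> x, iso_verts \<phi> y) \<in> parcs G \<longleftrightarrow> (x, y) \<in> parcs G"
    if "x \<in> pverts G" "y \<in> pverts G" for x y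
  proof
    assume "(x, y) \<in> parcs G"
    then show "(iso_verts \<phi> x, iso_verts \<phi> y) \<in> parcs G" using arc img(2) by (metis imageI)
  next
    assume "(iso_verts \<phi> x, iso_verts \<phi> y) \<in> parcs G"
    then obtain x' y' where a: "(x', y') \<in> parcs G"
      "iso_arcs \<phi> (x', y') = (iso_verts \<phi> x, iso_verts \<phi> y)"
      using img(2) by (metis imageE surj_pair)
    then have "x' \<in> pverts G" "y' \<in> pverts G" using wf by auto
    moreover have "iso_verts \<phi> x' = iso_verts \<phi> x" "iso_verts \<phi> y' = iso_verts \<phi> y"
      using arc[OF a(1)] a(2) by simp_all
    ultimately have "x' = x" "y' = y" using inj_onD[OF inj] that by blast+
    with a show "(x, y) \<in> parcs G" by simp
  qed
  then show ?thesis using inj img by (simp add: vertex_automorphism_def bij_betw_def)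
qed

lemma arcs_ends_induce:
  "arcs_ends (with_proj G \<restriction> W) = parcs G \<inter> W \<times> W"
  by (auto simp: arcs_ends_def arc_to_ends_def)

context pair_bidirected_digraph
begin

lemma parcs_subset: "parcs G \<subseteq> pverts G \<times> pverts G"
  using in_arcsD1 in_arcsD2 by auto

lemma sym_parcs: "sym (parcs G)"
  using pair_sym_arcs by (simp add: symmetric_def)

lemma rays_in_verts: "r \<in> rays G \<Longrightarrow> r i \<in> pverts G"
  using parcs_subset by (auto simp: rays_def)

lemma end_rel_refl:
  assumes r: "r \<in> rays G" shows "(r, r) \<in> end_rel G"
proof -
  have "\<exists>C \<in> components_minus G S. \<exists>m n. r ` {m..} \<subseteq> C \<and> r ` {n..} \<subseteq> C" if S: "finite S" for S
  proof -
    let ?H = "with_proj G \<restriction> (pverts G - S)"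
    interpret H: wf_digraph ?H by (rule wellformed_induce_subgraph)
    have "finite (r -` S)" using r S by (auto simp: rays_def intro: finite_vimageI)
    then obtain m where m: "\<And>i. r i \<in> S \<Longrightarrow> i < m" by (auto simp: finite_nat_set_iff_bounded)
    have vert: "r i \<in> pverts G - S" if "m \<le> i" for i
      using m[of i] that rays_in_verts[OF r, of i] by auto
    have "r m \<rightarrow>\<^sup>*\<^bsub>?H\<^esub> r i" if "m \<le> i" for i
      using that
    proof (induction i rule: dec_induct)
      case base
      then show ?case using vert[of m] by (simp add: reachable_def rtrancl_on.rtrancl_on_refl)
    next
      case (step i)
      have "(r i, r (Suc i)) \<in> arcs_ends ?H"
        using r vert[of i] vert[of "Suc i"] step by (auto simp: arcs_ends_induce rays_def)
      with step.IH show ?case by (rule H.reachable_adj_trans)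
    qed
    moreover have "symmetric ?H"
      using sym_parcs by (auto simp: symmetric_def arcs_ends_induce sym_def)
    ultimately have "r ` {m..} \<subseteq> H.scc_of (r m)"
      using symmetric_reachable[of ?H] by (auto simp: H.scc_of_def)
    moreover have "H.scc_of (r m) \<in> components_minus G S"
      unfolding components_minus_def using vert[of m] by (intro H.scc_of_in_sccs_verts) simp
    ultimately show ?thesis by blast
  qed
  with r show ?thesis by (auto simp: end_rel_def)
qed

lemma one_ended_imp_end_rel:
  assumes "one_ended G" "r \<in> rays G" "s \<in> rays G"
  shows "(r, s) \<in> end_rel G"
proof -
  have "end_rel G `` {r} \<in> graph_ends G" "end_rel G `` {s} \<in> graph_ends G"
    using assms(2,3) by (auto simp: graph_ends_def intro: quotientI)
  then have "end_rel G `` {r} = end_rel G `` {s}" using assms(1) by (auto simp: one_ended_def)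
  with end_rel_refl[OF assms(3)] show ?thesis by blast
qed

lemma one_ended_imp_end_eq_rays:
  assumes "one_ended G" "\<omega> \<in> graph_ends G"
  shows "\<omega> = rays G"
proof -
  obtain r where r: "r \<in> rays G" "\<omega> = end_rel G `` {r}"
    using assms(2) by (auto simp: graph_ends_def elim: quotientE)
  moreover have "end_rel G \<subseteq> rays G \<times> rays G" by (auto simp: end_rel_def)
  ultimately show ?thesis using one_ended_imp_end_rel[OF assms(1)] by blast
qed

text \<open>
  Equivalent rays are not separated by a finite set \<open>N\<close>; that \<open>N\<close> separates \<open>U\<close> from
  the rest of the graph is expressed by the condition on the neighbours of \<open>U\<close>.
\<close>

lemma end_rel_not_separated:
  assumes rs: "(r, s) \<in> end_rel G" and N: "finite N" "N \<subseteq> pverts G"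
    and U: "parcs G `` U \<subseteq> U \<union> N" and r: "range r \<subseteq> U"
  shows "\<exists>n. s n \<in> U"
proof -
  let ?H = "with_proj G \<restriction> (pverts G - N)"
  obtain C m n where C: "C \<in> components_minus G N" "r ` {m..} \<subseteq> C" "s ` {n..} \<subseteq> C"
    using rs N by (auto simp: end_rel_def)
  have "r m \<in> C" "s n \<in> C" using C by auto
  then have "r m \<rightarrow>\<^sup>*\<^bsub>?H\<^esub> s n"
    using C(1) by (auto simp: components_minus_def pre_digraph.sccs_verts_def)
  then have "(r m, s n) \<in> (arcs_ends ?H)\<^sup>*" by (rule reachable_rtranclI)
  then have "s n \<in> U"
  proof (induction rule: rtrancl_induct)
    case base
    then show ?case using r by blast
  next
    case (step y z)
    then show ?case using U by (auto simp: arcs_ends_induce)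
  qed
  then show ?thesis ..
qed

text \<open>By transitivity a ray starts at every vertex, and all these rays are equivalent.\<close>

lemma transitive_one_ended_connected:
  assumes tr: "transitive_graph G" and one: "one_ended G" and r: "r \<in> rays G"
    and uv: "u \<in> pverts G" "v \<in> pverts G"
  shows "(u, v) \<in> (parcs G)\<^sup>*"
proof -
  have tail: "(t 0, t i) \<in> (parcs G)\<^sup>*" if "t \<in> rays G" for t i
    using that by (induction i) (auto simp: rays_def intro: rtrancl_into_rtrancl)
  have ex: "\<exists>t \<in> rays G. t 0 = x" if x: "x \<in> pverts G" for x
  proof -
    obtain \<phi> where \<phi>: "graph_automorphism G \<phi>" "iso_verts \<phi> (r 0) = x"
      using tr x rays_in_verts[OF r] unfolding transitive_graph_def by blast
    have "vertex_automorphism G (iso_verts \<phi>)"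
      by (rule vertex_automorphism_iso_verts[OF parcs_subset \<phi>(1)])
    then have "(\<lambda>i. iso_verts \<phi> (r i)) \<in> rays G"
      using r rays_in_verts[OF r]
      by (auto simp: rays_def vertex_automorphism_def bij_betw_def inj_def dest: inj_onD)
    with \<phi>(2) show ?thesis by auto
  qed
  obtain t t' where t: "t \<in> rays G" "t 0 = u" "t' \<in> rays G" "t' 0 = v" using ex uv by metis
  have "range t \<subseteq> (parcs G)\<^sup>* `` {u}" using tail[OF t(1)] t(2) by auto
  moreover have "parcs G `` ((parcs G)\<^sup>* `` {u}) \<subseteq> (parcs G)\<^sup>* `` {u} \<union> {}"
    by (auto intro: rtrancl_into_rtrancl)
  ultimately obtain n where "t' n \<in> (parcs G)\<^sup>* `` {u}"
    using end_rel_not_separated[OF one_ended_imp_end_rel[OF one t(1,3)], of "{}"] by blast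
  moreover have "(t' n, v) \<in> (parcs G)\<^sup>*"
    using tail[OF t(3), of n] t(4) sym_rtrancl[OF sym_parcs] by (auto simp: sym_def)
  ultimately show ?thesis by (auto intro: rtrancl_trans)
qed

end

section \<open>The degree of the end\<close>

context pair_bidirected_digraph
begin

lemma many_disjoint_rays:
  assumes tr: "transitive_graph G" and one: "one_ended G" and r: "r \<in> rays G"
  shows "\<exists>F. disjoint_rays_in (rays G) F \<and> card F = Suc k"
proof (rule ccontr)
  assume few: "\<not> ?thesis"
  have "range r \<subseteq> pverts G" using rays_in_verts[OF r] by blast
  moreover have "infinite (range r)" using r by (simp add: rays_def range_inj_infinite)
  ultimately have inf: "infinite (pverts G)" using finite_subset by blast
  have aut: "\<exists>g. vertex_automorphism G g \<and> g u = v" if "u \<in> pverts G" "v \<in> pverts G" for u v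
    using tr that vertex_automorphism_iso_verts[OF parcs_subset]
    unfolding transitive_graph_def by blast
  obtain w where w: "w \<in> pverts G" "finite (parcs G `` {w})"
    using disjoint_rays_infinite_degree[OF parcs_subset _ inf, of k] few by blast
  have fin: "finite (parcs G `` {v})" if v: "v \<in> pverts G" for v
  proof -
    obtain g where g: "vertex_automorphism G g" "g w = v" using aut w v by blast
    have "parcs G `` {v} \<subseteq> g ` (parcs G `` {w})"
    proof
      fix y assume y: "y \<in> parcs G `` {v}"
      then obtain x where "x \<in> pverts G" "y = g x"
        using g(1) parcs_subset unfolding vertex_automorphism_def bij_betw_def by blast
      then show "y \<in> g ` (parcs G `` {w})"
        using y g w(1) unfolding vertex_automorphism_def by blast
    qed
    then show ?thesis using w(2) by (rule finite_surj[rotated])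
  qed
  interpret T: transitive_locally_finite G
    using parcs_subset sym_parcs transitive_one_ended_connected[OF tr one r] fin inf aut
    by unfold_locales
  have "\<exists>F. finite F \<and> F \<subseteq> pverts G \<and> card (closed_nbhd (parcs G) F) \<le> card F + k \<and> M < card F" for M
    using disjoint_rays_of_isoperimetry[OF parcs_subset fin inf, of k M] few by (meson not_less)
  then obtain R s U where R: "R \<in> rays G" "s \<in> rays G" "U \<subseteq> pverts G"
    "finite (closed_nbhd (parcs G) U - U)" "range R \<subseteq> U" "range s \<inter> closed_nbhd (parcs G) U = {}"
    using T.separated_rays[of k] by blast
  have "\<exists>n. s n \<in> U"
  proof (rule end_rel_not_separated[OF one_ended_imp_end_rel[OF one R(1,2)] R(4)])
    show "closed_nbhd (parcs G) U - U \<subseteq> pverts G" using T.closed_nbhd_subset[OF R(3)] by blast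
    show "parcs G `` U \<subseteq> U \<union> (closed_nbhd (parcs G) U - U)" by (auto simp: closed_nbhd_def)
  qed (rule R(5))
  then show False using R(6) subset_closed_nbhd[of U "parcs G"] by blast
qed

end

theorem theorem1p3:
  fixes G :: "'a pair_pre_digraph"
  assumes "pair_bidirected_digraph G"
    and "transitive_graph G"
    and "one_ended G"
    and "\<omega> \<in> graph_ends G"
  shows "end_vertex_degree \<omega> = \<infinity>"
proof -
  interpret pair_bidirected_digraph G by fact
  have \<omega>: "\<omega> = rays G" by (rule one_ended_imp_end_eq_rays[OF assms(3,4)])
  obtain r where "r \<in> rays G" using assms(4) by (auto simp: graph_ends_def elim: quotientE)
  then have "\<exists>F. disjoint_rays_in \<omega> F \<and> card F = Suc k" for k
    unfolding \<omega> by (rule many_disjoint_rays[OF assms(2,3)])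
  then have "\<not> max_disjoint_rays \<omega> k" for k
    unfolding max_disjoint_rays_def by (metis not_less_eq_eq order_refl)
  then show ?thesis by (simp add: end_vertex_degree_def)
qed

end
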